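(* Let $G$ be a non-cyclic group and suppose that $G_{2,4}\neq G$ and that the center $Z(G)$ does not have elements of order $2$. Then $G$ has no Lee metrics.
   Context: $G_{2,4}$ denotes the subgroup of $G$ generated by all the elements of $G$ of order $2$ and of order $4$ (trivial if there are none). The group $G$ may be finite or infinite. All metrics on groups are integral (integer valued) and right translation invariant: $d(gh,g'h)=d(g,g')$ for all $g,g',h\in G$. The weight of $d$ is $w(x)=d(x,e)$, $e$ the identity of $G$. The partition induced by $d$, denoted $P(G,d)$, is the set of classes of the equivalence relation $g\sim h\Leftrightarrow w(g)=w(h)$. Such a metric is gapless if the set of values of $w$ is exactly $\{0,1,\ldots,n\}$ when $P(G,d)$ has finitely many parts, $n$ of them different from $\{e\}$, and is exactly $\mathbb{N}_0=\{0,1,2,\ldots\}$ when $P(G,d)$ has infinitely many parts. The Lee partition of $G$ is $\mathcal{P}_{Lee}(G)=\{\{a,a^{-1}\}:a\in G\}$. A Lee metric on $G$ is a gapless metric $d$ on $G$ with $P(G,d)=\mathcal{P}_{Lee}(G)$. *)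

theory Defs
  imports "HOL-Analysis.Abstract_Metric_Spaces" "HOL-Algebra.Algebra"
begin

definition G24 :: "('a, 'b) monoid_scheme \<Rightarrow> 'a set" where
  "G24 G = generate G {x \<in> carrier G. group.ord G x = 2 \<or> group.ord G x = 4}"

definition group_center :: "('a, 'b) monoid_scheme \<Rightarrow> 'a set" where
  "group_center G = {z \<in> carrier G. \<forall>x\<in>carrier G. z \<otimes>\<^bsub>G\<^esub> x = x \<otimes>\<^bsub>G\<^esub> z}"

(* The library locale also demands symmetry and nonnegativity off the carrier. This is no
   restriction, since every metric on the carrier extends by 0. *)
definition group_metric :: "('a, 'b) monoid_scheme \<Rightarrow> ('a \<Rightarrow> 'a \<Rightarrow> int) \<Rightarrow> bool" where
  "group_metric G d \<longleftrightarrow>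
     Metric_space (carrier G) (\<lambda>x y. real_of_int (d x y)) \<and>
     (\<forall>g\<in>carrier G. \<forall>g'\<in>carrier G. \<forall>h\<in>carrier G.
        d (g \<otimes>\<^bsub>G\<^esub> h) (g' \<otimes>\<^bsub>G\<^esub> h) = d g g')"

definition weight :: "('a, 'b) monoid_scheme \<Rightarrow> ('a \<Rightarrow> 'a \<Rightarrow> int) \<Rightarrow> 'a \<Rightarrow> int" where
  "weight G d x = d x \<one>\<^bsub>G\<^esub>"

definition metric_partition ::
    "('a, 'b) monoid_scheme \<Rightarrow> ('a \<Rightarrow> 'a \<Rightarrow> int) \<Rightarrow> 'a set set" where
  "metric_partition G d =
     carrier G // {(g, h) \<in> carrier G \<times> carrier G. weight G d g = weight G d h}"

definition gapless :: "('a, 'b) monoid_scheme \<Rightarrow> ('a \<Rightarrow> 'a \<Rightarrow> int) \<Rightarrow> bool" where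
  "gapless G d \<longleftrightarrow>
     weight G d ` carrier G =
       (if finite (metric_partition G d)
        then {0..int (card (metric_partition G d - {{\<one>\<^bsub>G\<^esub>}}))}
        else {0..})"

definition Lee_partition :: "('a, 'b) monoid_scheme \<Rightarrow> 'a set set" where
  "Lee_partition G = {{a, inv\<^bsub>G\<^esub> a} | a. a \<in> carrier G}"

definition Lee_metric :: "('a, 'b) monoid_scheme \<Rightarrow> ('a \<Rightarrow> 'a \<Rightarrow> int) \<Rightarrow> bool" where
  "Lee_metric G d \<longleftrightarrow>
     group_metric G d \<and> gapless G d \<and> metric_partition G d = Lee_partition G"

end

theory Submission
  imports Defs
begin

text \<open>
  The weight of a Lee metric separates elements up to inversion, and multiplication by the element
  \<open>a\<close> of weight \<open>1\<close> changes it by at most \<open>1\<close>. Follow the weight along a coset \<open>\<langle>a\<rangle>x\<close>. If two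
  consecutive elements have equal weight, the first one, \<open>y\<close>, satisfies \<open>y\<^sup>2 = a\<^sup>-\<^sup>1\<close> and hence
  commutes with \<open>a\<close>. Otherwise the weight increases on both sides of a minimum \<open>y\<close>, and equal
  weights force \<open>a y a\<^sup>-\<^sup>1 = y\<^sup>-\<^sup>1\<close> if \<open>a\<^sup>2 \<noteq> 1\<close>, and \<open>a\<^sup>2 y a\<^sup>-\<^sup>2 = y\<^sup>-\<^sup>1\<close> as well if \<open>a\<^sup>4 \<noteq> 1\<close>; in the latter case
  \<open>y\<close> again commutes with \<open>a\<close>.

  So if \<open>a\<close> is not central, then \<open>a\<^sup>4 = 1\<close>, and every element outside the centralizer of \<open>a\<close> turns
  out to be a product of elements of order \<open>2\<close> or \<open>4\<close>. The complement of a proper subgroup generates the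
  group, so \<open>G\<^sub>2\<^sub>,\<^sub>4 = G\<close>. If \<open>a\<close> is central, it has finite order, since otherwise its powers take
  every weight; the order is odd, since there is no central involution. Then every element is a
  power of \<open>a\<close> times some \<open>z\<close> with \<open>z\<^sup>2 = 1\<close>, these \<open>z\<close> commute with each other, and any \<open>z \<noteq> 1\<close> is a
  central involution.
\<close>

section \<open>Commuting powers, small orders and membership in \<open>G24\<close>\<close>

lemma (in group) inv_mult_cancel_left [simp]:
  assumes "x \<in> carrier G" "y \<in> carrier G"
  shows "inv x \<otimes> (x \<otimes> y) = y" "x \<otimes> (inv x \<otimes> y) = y"
  using assms by (simp_all add: m_assoc[symmetric])

lemma (in group) inv_commute:
  assumes "x \<in> carrier G" "y \<in> carrier G" "x \<otimes> y = y \<otimes> x"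
  shows "inv x \<otimes> y = y \<otimes> inv x"
proof -
  have "inv x \<otimes> y = inv x \<otimes> (y \<otimes> x) \<otimes> inv x" using assms(1,2) by (simp add: m_assoc)
  also have "\<dots> = inv x \<otimes> (x \<otimes> y) \<otimes> inv x" by (simp only: assms(3))
  also have "\<dots> = y \<otimes> inv x" using assms(1,2) by (simp add: m_assoc[symmetric])
  finally show ?thesis .
qed

lemma (in group) int_pow_commute:
  fixes i :: int
  assumes x: "x \<in> carrier G" and y: "y \<in> carrier G" and comm: "x \<otimes> y = y \<otimes> x"
  shows "x [^] i \<otimes> y = y \<otimes> x [^] i"
proof -
  have nat: "x [^] n \<otimes> y = y \<otimes> x [^] n" for n :: nat
  proof (induction n)
    case (Suc n)
    have "x [^] Suc n \<otimes> y = x [^] n \<otimes> (x \<otimes> y)" using x y by (simp add: m_assoc)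
    also have "\<dots> = x [^] n \<otimes> (y \<otimes> x)" by (simp only: comm)
    also have "\<dots> = x [^] n \<otimes> y \<otimes> x" using x y by (simp add: m_assoc)
    also have "\<dots> = y \<otimes> x [^] n \<otimes> x" by (simp only: Suc)
    also have "\<dots> = y \<otimes> x [^] Suc n" using x y by (simp add: m_assoc)
    finally show ?case .
  qed (use y in simp)
  have "inv (x [^] nat (- i)) \<otimes> y = y \<otimes> inv (x [^] nat (- i))"
    using inv_commute[OF _ y nat] x by blast
  then show ?thesis
    using nat[of "nat i"] by (simp only: int_pow_def2 simp_thms split: if_split)
qed

lemma (in group) pow_eq_diff:
  fixes i j :: int
  assumes "x \<in> carrier G" "x [^] i = x [^] j"
  shows "x [^] (i - j) = \<one>"
  using assms by (simp add: int_pow_diff)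

lemma (in group) ord_eq_2I:
  assumes "x \<in> carrier G" "x \<noteq> \<one>" "x \<otimes> x = \<one>"
  shows "ord x = 2"
proof -
  have "ord x dvd 2" using assms pow_eq_id[of x 2] by (simp add: numeral_2_eq_2)
  moreover have "ord x \<noteq> 1" using assms ord_eq_1 by blast
  ultimately show ?thesis by (metis prime_nat_iff two_is_prime_nat)
qed

lemma (in group) ord_eq_4I:
  assumes "x \<in> carrier G" "x \<otimes> x \<noteq> \<one>" "x \<otimes> x \<otimes> (x \<otimes> x) = \<one>"
  shows "ord x = 4"
proof -
  have "ord x dvd 4" using assms pow_eq_id[of x 4] by (simp add: numeral_eq_Suc m_assoc)
  moreover have "\<not> ord x dvd 2" using assms pow_eq_id[of x 2] by (simp add: numeral_2_eq_2)
  moreover have "n = 1 \<or> n = 2 \<or> n = 4" if "n dvd 4" for n :: nat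
  proof -
    have "n \<le> 4" using that by (simp add: dvd_imp_le)
    then have "n \<in> {0, 1, 2, 3, 4}" by auto
    then show ?thesis using that by auto
  qed
  ultimately show ?thesis by (metis dvd_refl one_dvd)
qed

lemma (in group) G24_subgroup: "subgroup (G24 G) G"
  unfolding G24_def by (rule generate_is_subgroup) auto

text \<open>Orders 1, 2 and 4 in a single test: the identity, which is no generator, enters as the
  neutral element of the subgroup.\<close>

lemma (in group) G24_incl:
  assumes "x \<in> carrier G" "x \<otimes> x \<otimes> (x \<otimes> x) = \<one>"
  shows "x \<in> G24 G"
proof (cases "x \<otimes> x = \<one>")
  case True
  show ?thesis
  proof (cases "x = \<one>")
    case True
    then show ?thesis using G24_subgroup subgroup.one_closed by blast
  next
    case False
    then show ?thesis using ord_eq_2I[OF assms(1) False True] assms(1)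
      unfolding G24_def by (blast intro: generate.incl)
  qed
next
  case False
  then show ?thesis using ord_eq_4I[OF assms(1) False assms(2)] assms(1)
    unfolding G24_def by (blast intro: generate.incl)
qed

section \<open>Weights along the cosets of the powers of \<open>a\<close>\<close>

locale lee_weight = group G for G (structure) +
  fixes w :: "'a \<Rightarrow> int" and a :: 'a
  assumes weight_nonneg: "x \<in> carrier G \<Longrightarrow> 0 \<le> w x"
    and weight_one: "w \<one> = 0"
    and weight_mult_le: "x \<in> carrier G \<Longrightarrow> y \<in> carrier G \<Longrightarrow> w (x \<otimes> y) \<le> w x + w y"
    and weight_eqD: "x \<in> carrier G \<Longrightarrow> y \<in> carrier G \<Longrightarrow> w x = w y \<Longrightarrow> y = x \<or> y = inv x"
    and weight_inv: "x \<in> carrier G \<Longrightarrow> w (inv x) = w x"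
    and a_closed [simp]: "a \<in> carrier G"
    and weight_a: "w a = 1"
begin

lemma a_neq_one: "a \<noteq> \<one>"
  using weight_a weight_one by auto

lemma weight_step_left:
  assumes "x \<in> carrier G"
  shows "\<bar>w (a \<otimes> x) - w x\<bar> \<le> 1"
proof -
  have "w (a \<otimes> x) \<le> 1 + w x"
    using weight_mult_le[of a x] weight_a assms by simp
  moreover have "w (inv a \<otimes> (a \<otimes> x)) \<le> 1 + w (a \<otimes> x)"
    using weight_mult_le[of "inv a" "a \<otimes> x"] weight_a weight_inv[of a] assms by simp
  moreover have "inv a \<otimes> (a \<otimes> x) = x"
    using assms by simp
  ultimately show ?thesis by simp
qed

lemma weight_step_right:
  assumes "x \<in> carrier G"
  shows "\<bar>w (x \<otimes> a) - w x\<bar> \<le> 1"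
proof -
  have "w (x \<otimes> a) \<le> w x + 1"
    using weight_mult_le[of x a] weight_a assms by simp
  moreover have "w (x \<otimes> a \<otimes> inv a) \<le> w (x \<otimes> a) + 1"
    using weight_mult_le[of "x \<otimes> a" "inv a"] weight_a weight_inv[of a] assms by simp
  moreover have "x \<otimes> a \<otimes> inv a = x"
    using assms by (simp add: m_assoc)
  ultimately show ?thesis by simp
qed

lemma pow_Suc_mult:
  assumes "x \<in> carrier G"
  shows "a [^] (j + 1 :: int) \<otimes> x = a \<otimes> (a [^] j \<otimes> x)"
  using assms int_pow_mult[of a 1 j] by (simp add: add.commute m_assoc)

lemma coset_weight_step:
  fixes j :: int
  assumes "x \<in> carrier G"
  shows "\<bar>w (a [^] (j + 1) \<otimes> x) - w (a [^] j \<otimes> x)\<bar> \<le> 1"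
  using assms weight_step_left[of "a [^] j \<otimes> x"] by (simp add: pow_Suc_mult)

text \<open>Applied with \<open>j = - i\<close>, where the second alternative says that conjugation
  by \<open>a [^] i\<close> inverts \<open>y\<close>.\<close>

lemma coset_weight_eqD:
  fixes i j :: int
  assumes "y \<in> carrier G" "w (a [^] i \<otimes> y) = w (a [^] j \<otimes> y)"
  shows "a [^] i = a [^] j \<or> a [^] i \<otimes> y = inv y \<otimes> a [^] (- j)"
proof -
  have "a [^] i \<otimes> y = a [^] j \<otimes> y \<or> a [^] i \<otimes> y = inv (a [^] j \<otimes> y)"
    using weight_eqD[of "a [^] j \<otimes> y" "a [^] i \<otimes> y"] assms by simp
  then show ?thesis
    using assms(1) by (simp add: inv_mult_group int_pow_neg)
qed

lemma coset_cases:
  assumes x: "x \<in> carrier G"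
  obtains (square) i :: int
    where "a [^] i \<otimes> x \<otimes> (a [^] i \<otimes> x) = inv a"
  | (minimum) i :: int
    where "\<And>j :: int. w (a [^] i \<otimes> x) \<le> w (a [^] j \<otimes> (a [^] i \<otimes> x))"
      and "\<And>j :: int. \<bar>w (a [^] (j + 1) \<otimes> (a [^] i \<otimes> x)) - w (a [^] j \<otimes> (a [^] i \<otimes> x))\<bar> = 1"
proof (cases "\<exists>i :: int. w (a [^] (i + 1) \<otimes> x) = w (a [^] i \<otimes> x)")
  case True
  then obtain i :: int where i: "w (a [^] (i + 1) \<otimes> x) = w (a [^] i \<otimes> x)" by blast
  define y where "y = a [^] i \<otimes> x"
  have y: "y \<in> carrier G" using x by (simp add: y_def)
  have "w (a \<otimes> y) = w y" using i x by (simp add: pow_Suc_mult y_def)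
  then have "a \<otimes> y = y \<or> a \<otimes> y = inv y"
    using weight_eqD[of y "a \<otimes> y"] y by simp
  then have "a \<otimes> y = inv y" using y a_neq_one by (simp add: l_cancel_one')
  then have "a \<otimes> y \<otimes> y = \<one>" using y by simp
  then have "y \<otimes> y = inv a" using y
    by (metis a_closed inv_equality inv_inv m_assoc m_closed)
  then show thesis using square y_def by blast
next
  case False
  \<comment> \<open>Weights are nonnegative, so \<open>nat\<close> loses nothing, and well-ordering
    gives a minimum even on an infinite coset.\<close>
  define f where "f j = nat (w (a [^] j \<otimes> x))" for j :: int
  obtain i where i: "\<And>j. f i \<le> f j"
    using ex_has_least_nat[of "\<lambda>_. True" undefined f] by auto
  have shift: "a [^] j \<otimes> (a [^] i \<otimes> x) = a [^] (j + i) \<otimes> x" for j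
    using x by (simp add: int_pow_mult m_assoc)
  show thesis
  proof (rule minimum[of i])
    fix j :: int
    show "w (a [^] i \<otimes> x) \<le> w (a [^] j \<otimes> (a [^] i \<otimes> x))"
      using i[of "j + i"] weight_nonneg[of "a [^] (j + i) \<otimes> x"] x
      unfolding f_def shift by simp
    show "\<bar>w (a [^] (j + 1) \<otimes> (a [^] i \<otimes> x)) - w (a [^] j \<otimes> (a [^] i \<otimes> x))\<bar> = 1"
      using coset_weight_step[OF x, of "j + i"] False[simplified, rule_format, of "j + i"]
      unfolding shift by (simp add: algebra_simps)
  qed
qed

text \<open>At a minimum both neighbours must lie one higher, so they share a weight. They are
  distinct because \<open>a \<otimes> a \<noteq> \<one>\<close>, hence mutually inverse.\<close>

lemma minimum_conj:
  assumes y: "y \<in> carrier G" and sq: "a \<otimes> a \<noteq> \<one>"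
    and min: "\<And>j :: int. w y \<le> w (a [^] j \<otimes> y)"
    and step: "\<And>j :: int. \<bar>w (a [^] (j + 1) \<otimes> y) - w (a [^] j \<otimes> y)\<bar> = 1"
  shows "w (a [^] (1::int) \<otimes> y) = w y + 1" "w (a [^] (- 1::int) \<otimes> y) = w y + 1"
    "a \<otimes> y = inv y \<otimes> a"
proof -
  show 1: "w (a [^] (1::int) \<otimes> y) = w y + 1"
    using min[of 1] step[of 0] y by simp
  show 2: "w (a [^] (- 1::int) \<otimes> y) = w y + 1"
    using min[of "- 1"] step[of "- 1"] y by simp
  have "a [^] (1 - (- 1)::int) = a \<otimes> a"
    using int_pow_mult[of a 1 1] by simp
  then show "a \<otimes> y = inv y \<otimes> a"
    using coset_weight_eqD[OF y, of 1 "- 1"] 1 2 sq pow_eq_diff[OF a_closed, of 1 "- 1"] by auto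
qed

text \<open>Commuting with \<open>a\<close> depends only on the coset, so it can be tested at the
  representative that \<open>coset_cases\<close> supplies.\<close>

lemma commute_of_shift:
  fixes i :: int
  assumes x: "x \<in> carrier G" and "a \<otimes> (a [^] i \<otimes> x) = a [^] i \<otimes> x \<otimes> a"
  shows "a \<otimes> x = x \<otimes> a"
proof -
  have "a [^] i \<otimes> (a \<otimes> x) = a \<otimes> (a [^] i \<otimes> x)"
    using x int_pow_mult[of a i 1] int_pow_mult[of a 1 i]
    by (simp add: m_assoc[symmetric] add.commute)
  also have "\<dots> = a [^] i \<otimes> (x \<otimes> a)" using assms by (simp add: m_assoc)
  finally show ?thesis using x by simp
qed

text \<open>The hypothesis amounts to y a y = a; take inverses on both sides.\<close>

lemma inv_conj:
  assumes y: "y \<in> carrier G" and conj: "a \<otimes> y = inv y \<otimes> a"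
  shows "inv a \<otimes> y = inv y \<otimes> inv a"
proof -
  have "y \<otimes> (a \<otimes> y) = a" using y by (simp add: conj m_assoc[symmetric])
  then have "inv (y \<otimes> (a \<otimes> y)) = inv a" by simp
  then have "inv y \<otimes> (inv a \<otimes> inv y) = inv a" using y by (simp add: inv_mult_group m_assoc)
  then have "inv y \<otimes> (inv a \<otimes> inv y) \<otimes> y = inv a \<otimes> y" by simp
  then show ?thesis using y by (simp add: m_assoc)
qed

text \<open>Here \<open>a\<close> is a power of \<open>y\<close>, namely the inverse of its
  square.\<close>

lemma commute_of_square:
  assumes y: "y \<in> carrier G" and sq: "y \<otimes> y = inv a"
  shows "a \<otimes> y = y \<otimes> a"
proof -
  have "inv a \<otimes> y = y \<otimes> inv a" using y by (simp add: sq[symmetric] m_assoc)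
  then show ?thesis using inv_commute[of "inv a" y] y by simp
qed

section \<open>The case of a non-central \<open>a\<close>\<close>

lemma commute_of_fourth_power_neq_one:
  assumes x: "x \<in> carrier G" and four: "a [^] (4::int) \<noteq> \<one>"
  shows "a \<otimes> x = x \<otimes> a"
  using x
proof (cases x rule: coset_cases)
  case (square i)
  then show ?thesis
    using commute_of_shift[OF x, of i] commute_of_square[of "a [^] i \<otimes> x"] x by simp
next
  case (minimum i)
  define y where "y = a [^] i \<otimes> x"
  have y: "y \<in> carrier G" using x by (simp add: y_def)
  note min = minimum(1)[folded y_def] and step = minimum(2)[folded y_def]
  have two: "a [^] (2::int) = a \<otimes> a" using int_pow_mult[of a 1 1] by simp
  have sq: "a \<otimes> a \<noteq> \<one>"
    using four int_pow_mult[of a 2 2] two by auto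
  note conj = minimum_conj[OF y sq min step]
  have four': "a [^] (- 4::int) \<noteq> \<one>" using four by (simp add: int_pow_eq_id)
  have two': "a [^] (2::int) \<noteq> \<one>" using sq two by simp
  then have two'': "a [^] (- 2::int) \<noteq> \<one>" by (simp add: int_pow_eq_id)
  \<comment> \<open>A weight is shared by at most two elements, and \<open>w y + 1\<close> is already that of \<open>a y\<close> and its inverse.\<close>
  have unique: False if "w (a [^] j \<otimes> y) = w y + 1" "j = 3 \<or> j = - 3" for j :: int
  proof -
    have "a [^] j \<otimes> y = a [^] (1::int) \<otimes> y \<or> a [^] j \<otimes> y = inv (a [^] (1::int) \<otimes> y)"
      using weight_eqD[of "a [^] (1::int) \<otimes> y" "a [^] j \<otimes> y"] that conj(1) y by simp
    moreover have "inv (a [^] (1::int) \<otimes> y) = a [^] (- 1::int) \<otimes> y"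
    proof -
      have "inv a \<otimes> y = inv y \<otimes> inv a"
        using inv_conj[OF y conj(3)] .
      then show ?thesis using y by (simp add: inv_mult_group int_pow_neg)
    qed
    ultimately have "a [^] j = a [^] (1::int) \<or> a [^] j = a [^] (- 1::int)"
      using y by auto
    \<comment> \<open>For \<open>j\<close> equal to 3 or -3 these exponents are 2 and 4 up to sign
      and order.\<close>
    then have "a [^] (j - 1) = \<one> \<or> a [^] (j + 1) = \<one>"
      using pow_eq_diff[OF a_closed, of j 1] pow_eq_diff[OF a_closed, of j "- 1"] by auto
    then show False using that(2) four four' two' two'' by auto
  qed
  \<comment> \<open>A return to the minimum at exponent 2 would force weight \<open>w y + 1\<close>
    at exponent 3, which \<open>unique\<close> excludes.\<close>
  have "w (a [^] (2::int) \<otimes> y) \<noteq> w y"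
    using step[of 2] unique[of 3] min[of 3] by auto
  then have 2: "w (a [^] (2::int) \<otimes> y) = w y + 2"
    using step[of 1] conj(1) min[of 2] by auto
  have "w (a [^] (- 2::int) \<otimes> y) \<noteq> w y"
    using step[of "- 3"] unique[of "- 3"] min[of "- 3"] by auto
  then have m2: "w (a [^] (- 2::int) \<otimes> y) = w y + 2"
    using step[of "- 2"] conj(2) min[of "- 2"] by auto
  have "a [^] (2::int) \<otimes> y = inv y \<otimes> a [^] (2::int)"
    using coset_weight_eqD[OF y, of 2 "- 2"] 2 m2 four pow_eq_diff[OF a_closed, of 2 "- 2"] by auto
  \<comment> \<open>Both \<open>a\<close> and its square conjugate \<open>y\<close> to
    \<open>inv y\<close>; comparing the two leaves \<open>a\<close> commuting with
    \<open>y\<close>.\<close>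
  then have "a \<otimes> (a \<otimes> y) = inv y \<otimes> a \<otimes> a" using y by (simp add: two m_assoc)
  also have "\<dots> = a \<otimes> (y \<otimes> a)" using conj(3) y by (simp add: m_assoc[symmetric])
  finally have "a \<otimes> y = y \<otimes> a" using y by simp
  then show ?thesis using commute_of_shift[OF x] unfolding y_def by blast
qed

text \<open>At a minimum \<open>y\<close> of the coset, the square of \<open>a \<otimes> y\<close>
  is a conjugate of the involution \<open>a \<otimes> a\<close>. So \<open>a \<otimes> y\<close> has
  trivial fourth power, and \<open>x\<close> differs from it by a power of \<open>a\<close>.\<close>

lemma G24_of_ord_4:
  assumes x: "x \<in> carrier G" and sq: "a \<otimes> a \<noteq> \<one>" and four: "a \<otimes> a \<otimes> (a \<otimes> a) = \<one>"
    and nc: "a \<otimes> x \<noteq> x \<otimes> a"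
  shows "x \<in> G24 G"
  using x
proof (cases x rule: coset_cases)
  case (square i)
  then show ?thesis
    using commute_of_shift[OF x, of i] commute_of_square[of "a [^] i \<otimes> x"] x nc by simp
next
  case (minimum i)
  define y where "y = a [^] i \<otimes> x"
  have y: "y \<in> carrier G" using x by (simp add: y_def)
  have conj: "a \<otimes> y = inv y \<otimes> a"
    using minimum_conj(3)[OF y sq minimum(1)[folded y_def] minimum(2)[folded y_def]] .
  have "a \<otimes> y \<otimes> (a \<otimes> y) = inv y \<otimes> a \<otimes> (a \<otimes> y)"
    by (simp only: conj)
  also have "\<dots> = inv y \<otimes> (a \<otimes> a) \<otimes> y" using y by (simp add: m_assoc)
  finally have ay2: "a \<otimes> y \<otimes> (a \<otimes> y) = inv y \<otimes> (a \<otimes> a) \<otimes> y" .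
  have "inv y \<otimes> (a \<otimes> a) \<otimes> y \<otimes> (inv y \<otimes> (a \<otimes> a) \<otimes> y)
      = inv y \<otimes> (a \<otimes> a \<otimes> (a \<otimes> a)) \<otimes> y"
    using y by (simp add: m_assoc)
  also have "\<dots> = \<one>" using y four by simp
  finally have "a \<otimes> y \<in> G24 G"
    using G24_incl[of "a \<otimes> y"] y by (simp only: ay2) simp
  moreover have aG: "a \<in> G24 G" using G24_incl four by simp
  moreover have "x = a [^] (- i) \<otimes> (inv a \<otimes> (a \<otimes> y))"
    using x y by (simp add: y_def int_pow_neg)
  moreover have "a [^] (- i) \<in> G24 G"
    using subgroup_int_pow_closed[OF G24_subgroup aG] .
  ultimately show ?thesis
    using G24_subgroup by (metis subgroup.m_closed subgroup.m_inv_closed)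
qed

text \<open>Around the cycle \<open>x, a x, a x a, x a\<close> the weight changes by exactly one at each step, so two
  opposite vertices have equal weight and are mutually inverse.\<close>
lemma G24_of_ord_2:
  assumes x: "x \<in> carrier G" and sq: "a \<otimes> a = \<one>" and nc: "a \<otimes> x \<noteq> x \<otimes> a"
  shows "x \<in> G24 G"
proof -
  have inva: "inv a = a" using sq by (simp add: inv_equality)
  have invol: "z \<in> G24 G" if "z \<in> carrier G" "z \<otimes> z = \<one>" for z
    using G24_incl that by simp
  have aG: "a \<in> G24 G" using invol sq by simp
  \<comment> \<open>Equal weights would make \<open>inv a\<close> the square of \<open>z\<close>,
    and then \<open>z\<close> would commute with \<open>a\<close>.\<close>
  have edge_l: "w (a \<otimes> z) \<noteq> w z" if z: "z \<in> carrier G" and "a \<otimes> z \<noteq> z \<otimes> a" for z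
  proof
    assume "w (a \<otimes> z) = w z"
    then have "a \<otimes> z = z \<or> a \<otimes> z = inv z" using weight_eqD[of z "a \<otimes> z"] z by simp
    then have "a \<otimes> z = inv z" using z a_neq_one by (simp add: l_cancel_one')
    then have "z \<otimes> z = inv a" using z
      by (metis a_closed inv_equality inv_inv m_assoc m_closed l_inv)
    then show False using commute_of_square z that(2) by blast
  qed
  \<comment> \<open>Inversion preserves weights and turns right multiplication by
    \<open>a = inv a\<close> into left multiplication.\<close>
  have edge_r: "w (z \<otimes> a) \<noteq> w z" if z: "z \<in> carrier G" and nz: "a \<otimes> z \<noteq> z \<otimes> a" for z
  proof -
    have "w (a \<otimes> inv z) \<noteq> w (inv z)"
    proof (rule edge_l)
      show "a \<otimes> inv z \<noteq> inv z \<otimes> a"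
        using nz z by (metis a_closed inv_inv inv_mult_group inva m_closed)
    qed (use z in simp)
    moreover have "a \<otimes> inv z = inv (z \<otimes> a)" using z inva by (simp add: inv_mult_group)
    ultimately show ?thesis using z by (simp add: weight_inv)
  qed
  have cancel: "a \<otimes> (a \<otimes> z) = z" if "z \<in> carrier G" for z
    using that sq by (simp add: m_assoc[symmetric])
  have nax: "a \<otimes> (a \<otimes> x) \<noteq> a \<otimes> x \<otimes> a" using nc x by (simp add: m_assoc)
  have nxa: "a \<otimes> (x \<otimes> a) \<noteq> x \<otimes> a \<otimes> a"
    using nc x sq cancel by (metis a_closed m_assoc m_closed r_one)
  have "w (a \<otimes> x) \<noteq> w x" "w (x \<otimes> a) \<noteq> w x" "w (a \<otimes> x \<otimes> a) \<noteq> w (a \<otimes> x)"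
      "w (a \<otimes> x \<otimes> a) \<noteq> w (x \<otimes> a)"
    using edge_l[OF x nc] edge_r[OF x nc] edge_r[of "a \<otimes> x"] edge_l[of "x \<otimes> a"] nax nxa x
    by (simp_all add: m_assoc)
  moreover have "\<bar>w (a \<otimes> x) - w x\<bar> \<le> 1" "\<bar>w (x \<otimes> a) - w x\<bar> \<le> 1"
      "\<bar>w (a \<otimes> x \<otimes> a) - w (a \<otimes> x)\<bar> \<le> 1" "\<bar>w (a \<otimes> x \<otimes> a) - w (x \<otimes> a)\<bar> \<le> 1"
    using weight_step_left[of x] weight_step_right[of x] weight_step_right[of "a \<otimes> x"]
      weight_step_left[of "x \<otimes> a"] x by (simp_all add: m_assoc)
  \<comment> \<open>If the two neighbours of \<open>x\<close> differ in weight, they lie one above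
    and one below \<open>w x\<close>; the fourth vertex, within one of both, then has weight
    \<open>w x\<close>.\<close>
  ultimately have "w (a \<otimes> x \<otimes> a) = w x \<or> w (a \<otimes> x) = w (x \<otimes> a)" by linarith
  then show ?thesis
  proof
    assume "w (a \<otimes> x \<otimes> a) = w x"
    then have "a \<otimes> x \<otimes> a = x \<or> a \<otimes> x \<otimes> a = inv x"
      using weight_eqD[of x "a \<otimes> x \<otimes> a"] x by simp
    moreover have "a \<otimes> x \<otimes> a \<noteq> x"
      using nc x cancel by (metis a_closed m_assoc m_closed)
    ultimately have "a \<otimes> x \<otimes> a = inv x" by blast
    then have "a \<otimes> x \<otimes> (a \<otimes> x) = \<one>" using x by (simp add: m_assoc[symmetric])
    then have "a \<otimes> x \<in> G24 G" using invol x by simp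
    then show ?thesis
      using G24_subgroup aG cancel[OF x] by (metis subgroup.m_closed)
  next
    assume "w (a \<otimes> x) = w (x \<otimes> a)"
    then have "a \<otimes> x = x \<otimes> a \<or> a \<otimes> x = inv (x \<otimes> a)"
      using weight_eqD[of "x \<otimes> a" "a \<otimes> x"] x by simp
    then have "a \<otimes> x = a \<otimes> inv x" using nc x inva by (simp add: inv_mult_group)
    then have "x = inv x" using x by simp
    then have "x \<otimes> x = \<one>" using x by (metis r_inv)
    then show ?thesis using invol x by simp
  qed
qed

lemma G24_eq_carrier:
  assumes u: "u \<in> carrier G" and nc: "a \<otimes> u \<noteq> u \<otimes> a"
  shows "G24 G = carrier G"
proof -
  have four: "a [^] (4::int) = \<one>" using commute_of_fourth_power_neq_one u nc by blast
  have four': "a \<otimes> a \<otimes> (a \<otimes> a) = \<one>"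
    using four int_pow_mult[of a 2 2] int_pow_mult[of a 1 1] by simp
  have noncomm: "x \<in> G24 G" if "x \<in> carrier G" "a \<otimes> x \<noteq> x \<otimes> a" for x
    using G24_of_ord_2 G24_of_ord_4 that four' by blast
  have "x \<in> G24 G" if x: "x \<in> carrier G" for x
  proof (cases "a \<otimes> x = x \<otimes> a")
    case True
    \<comment> \<open>Multiplying by \<open>u\<close> moves \<open>x\<close> out of the centralizer
      of \<open>a\<close>, where \<open>noncomm\<close> applies.\<close>
    have "a \<otimes> (x \<otimes> u) \<noteq> x \<otimes> u \<otimes> a"
    proof
      assume "a \<otimes> (x \<otimes> u) = x \<otimes> u \<otimes> a"
      then have "x \<otimes> (a \<otimes> u) = x \<otimes> (u \<otimes> a)"
        using True x u by (simp add: m_assoc[symmetric])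
      then show False using nc x u by simp
    qed
    then have "x \<otimes> u \<in> G24 G" "u \<in> G24 G" using noncomm x u nc by auto
    moreover have "x = x \<otimes> u \<otimes> inv u" using x u by (simp add: m_assoc)
    ultimately show ?thesis
      using G24_subgroup by (metis subgroup.m_closed subgroup.m_inv_closed)
  qed (use noncomm x in blast)
  then show ?thesis using subgroup.subset[OF G24_subgroup] by blast
qed

section \<open>The case of a central \<open>a\<close>\<close>

text \<open>The weights of the powers with natural exponent start at 0, rise by at most 1 per step
  and never repeat, so the exponent \<open>i\<close> has weight exactly \<open>i\<close>. Every
  weight is thus taken by a power of \<open>a\<close>.\<close>

lemma mem_powers_if_infinite_order:
  assumes "ord a = 0" "x \<in> carrier G"
  shows "\<exists>i :: int. x = a [^] i"
proof -
  have pow_inj: "i = j" if "a [^] (i :: int) = a [^] j" for i j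
    using that assms(1) by (simp add: int_pow_eq)
  define f where "f i = w (a [^] int i)" for i :: nat
  have f_inj: "i = j" if "f i = f j" for i j
  proof -
    have "a [^] int j = a [^] int i \<or> a [^] int j = a [^] (- int i)"
      using weight_eqD[of "a [^] int i" "a [^] int j"] that by (simp add: f_def int_pow_neg)
    then show ?thesis by (auto dest!: pow_inj)
  qed
  have f_Suc: "f (Suc i) \<le> f i + 1" for i
    using coset_weight_step[of \<one> "int i"] by (simp add: f_def add.commute)
  have f0: "f 0 = 0" by (simp add: f_def weight_one)
  have f_nonneg: "0 \<le> f i" for i by (simp add: f_def weight_nonneg)
  have f_eq: "f i = int i" for i
  proof (induction i rule: less_induct)
    case (less i)
    show ?case
    proof (cases i)
      case (Suc k)
      have "f i \<le> int i" using f_Suc[of k] less[of k] Suc by simp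
      moreover have "\<not> f i < int i"
      proof
        assume lt: "f i < int i"
        \<comment> \<open>A value below \<open>i\<close> is already taken at a smaller index by the
          induction hypothesis, against injectivity.\<close>
        then have "f (nat (f i)) = f i" using less[of "nat (f i)"] f_nonneg[of i] by simp
        then have "nat (f i) = i" by (rule f_inj)
        then show False using lt f_nonneg[of i] by simp
      qed
      ultimately show ?thesis by simp
    qed (simp add: f0)
  qed
  have "w (a [^] w x) = w x"
    using f_eq[of "nat (w x)"] weight_nonneg[OF assms(2)] by (simp add: f_def)
  then have "x = a [^] w x \<or> x = inv (a [^] w x)"
    using weight_eqD[of "a [^] w x" x] assms(2) by simp
  then have "x = a [^] w x \<or> x = a [^] (- w x)"
    by (simp add: int_pow_neg)
  then show ?thesis by blast
qed

lemma exists_central_involution: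
  assumes central: "\<And>x. x \<in> carrier G \<Longrightarrow> a \<otimes> x = x \<otimes> a"
    and noncyclic: "\<not> cyclic_group G"
  shows "\<exists>z\<in>group_center G. ord z = 2"
proof -
  define m where "m = ord a"
  obtain x0 where x0: "x0 \<in> carrier G" "\<And>i :: int. x0 \<noteq> a [^] i"
  proof -
    have "range (\<lambda>i :: int. a [^] i) \<subset> carrier G"
      using noncyclic cyclic_group by (metis a_closed image_subsetI int_pow_closed psubsetI)
    then show thesis using that by blast
  qed
  have m0: "m \<noteq> 0" using mem_powers_if_infinite_order x0 m_def by blast
  have pow_central: "a [^] (i::int) \<otimes> x = x \<otimes> a [^] i" if x: "x \<in> carrier G" for i x
    using int_pow_commute[OF a_closed x central[OF x]] .
  show ?thesis
  proof (cases "even m")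
    case True
    then obtain k where k: "m = 2 * k" by blast
    have "ord (a [^] k) = 2"
      using ord_pow[of a k] k m0 by (simp add: m_def)
    moreover have "a [^] k \<in> group_center G"
      using pow_central[of _ "int k"] by (simp add: group_center_def int_pow_int)
    ultimately show ?thesis by blast
  next
    case False
    have am: "a [^] (int m) = \<one>" by (simp add: m_def int_pow_int)
    have sq: "a \<otimes> a \<noteq> \<one>"
      using False a_neq_one ord_eq_2I[of a] m_def by force
    have decomp: "\<exists>(i::int) z. z \<in> carrier G \<and> z \<otimes> z = \<one> \<and> x = a [^] i \<otimes> z"
      if x: "x \<in> carrier G" for x
      using x
    proof (cases x rule: coset_cases)
      case (square i)
      define y where "y = a [^] i \<otimes> x"
      have y: "y \<in> carrier G" using x by (simp add: y_def)
      have y2: "y [^] (2::int) = a [^] (- 1 :: int)"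
        using square int_pow_mult[of y 1 1] y by (simp add: y_def int_pow_neg)
      have y2k: "y [^] (2 * k) = a [^] (- k)" for k :: int
      proof -
        have "y [^] (2 * k) = (y [^] (2::int)) [^] k" using y by (simp add: int_pow_pow)
        also have "\<dots> = a [^] (- k)" unfolding y2 by (simp add: int_pow_pow)
        finally show ?thesis .
      qed
      obtain k where k: "m = 2 * k + 1" using False oddE by blast
      \<comment> \<open>Raising to the odd power \<open>m\<close> makes the square of
        \<open>z\<close> equal to \<open>a [^] (- m) = \<one>\<close>, while
        \<open>m = 2 * k + 1\<close> keeps \<open>z\<close> in the coset of
        \<open>y\<close>.\<close>
      define z where "z = y [^] int m"
      have z: "z \<in> carrier G" using y by (simp add: z_def)
      have "z \<otimes> z = y [^] (2 * int m)"
        using y int_pow_mult[of y "int m" "int m"] by (simp add: z_def)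
      also have "\<dots> = \<one>" using am by (simp add: y2k int_pow_neg)
      finally have zz: "z \<otimes> z = \<one>" .
      have "z = y [^] (2 * int k) \<otimes> y"
        using y int_pow_mult[of y "2 * int k" 1] by (simp add: z_def k add.commute)
      also have "\<dots> = a [^] (- int k) \<otimes> y" by (simp only: y2k)
      also have "\<dots> = a [^] (i - int k) \<otimes> x"
        using x int_pow_mult[of a "- int k" i] by (simp add: y_def m_assoc)
      finally have "x = a [^] (int k - i) \<otimes> z"
        using x int_pow_mult[of a "int k - i" "i - int k"] by (simp add: m_assoc[symmetric])
      then show ?thesis using z zz by blast
    next
      case (minimum i)
      define y where "y = a [^] i \<otimes> x"
      have y: "y \<in> carrier G" using x by (simp add: y_def)
      have "a \<otimes> y = inv y \<otimes> a"
        using minimum_conj(3)[OF y sq minimum(1)[folded y_def] minimum(2)[folded y_def]] .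
      then have "y = inv y" using central[OF y] y by simp
      then have "y \<otimes> y = \<one>" using y by (metis r_inv)
      moreover have "x = a [^] (- i) \<otimes> y"
        using x by (simp add: y_def int_pow_neg)
      ultimately show ?thesis using y by blast
    qed
    \<comment> \<open>By \<open>decomp\<close>, the square \<open>c\<close> of
      \<open>z \<otimes> u\<close> is a power of \<open>a\<close>, hence central, and conjugating
      \<open>u\<close> by \<open>z\<close> multiplies it by \<open>c\<close>. Both sides square to
      \<open>\<one>\<close>, so \<open>c \<otimes> c = \<one>\<close>; odd order then gives
      \<open>c = \<one>\<close>.\<close>
    have commute: "z \<otimes> u = u \<otimes> z"
      if z: "z \<in> carrier G" "z \<otimes> z = \<one>" and u: "u \<in> carrier G" "u \<otimes> u = \<one>" for z u
    proof -
      obtain j :: int and v where v: "v \<in> carrier G" "v \<otimes> v = \<one>" "z \<otimes> u = a [^] j \<otimes> v"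
        using decomp[of "z \<otimes> u"] z u by auto
      define c where "c = a [^] (j + j)"
      have c: "c \<in> carrier G" by (simp add: c_def)
      have "z \<otimes> u \<otimes> (z \<otimes> u) = a [^] j \<otimes> (v \<otimes> a [^] j) \<otimes> v"
        using v by (simp add: m_assoc)
      also have "\<dots> = a [^] j \<otimes> (a [^] j \<otimes> v) \<otimes> v"
        by (simp only: pow_central[OF v(1)])
      also have "\<dots> = a [^] j \<otimes> a [^] j \<otimes> (v \<otimes> v)"
        using v(1) by (simp add: m_assoc)
      also have "\<dots> = c" using v(2) int_pow_mult[of a j j] by (simp add: c_def)
      finally have zuzu: "z \<otimes> u \<otimes> (z \<otimes> u) = c" .
      have zuz: "z \<otimes> u \<otimes> z = c \<otimes> u"
      proof -
        have "z \<otimes> u \<otimes> z = z \<otimes> u \<otimes> z \<otimes> (u \<otimes> u)" using z u by simp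
        also have "\<dots> = z \<otimes> u \<otimes> (z \<otimes> u) \<otimes> u" using z(1) u(1) by (simp add: m_assoc)
        also have "\<dots> = c \<otimes> u" by (simp only: zuzu)
        finally show ?thesis .
      qed
      have "c \<otimes> c = c \<otimes> u \<otimes> (c \<otimes> u)"
      proof -
        have "c \<otimes> u \<otimes> (c \<otimes> u) = c \<otimes> (u \<otimes> c) \<otimes> u" using c u by (simp add: m_assoc)
        also have "\<dots> = c \<otimes> (c \<otimes> u) \<otimes> u"
          by (simp only: c_def pow_central[OF u(1)])
        also have "\<dots> = c \<otimes> c \<otimes> (u \<otimes> u)"
          using c u(1) by (simp add: m_assoc)
        finally show ?thesis using u c by simp
      qed
      also have "\<dots> = z \<otimes> u \<otimes> z \<otimes> (z \<otimes> u \<otimes> z)" by (simp add: zuz)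
      also have "\<dots> = z \<otimes> u \<otimes> (z \<otimes> z) \<otimes> u \<otimes> z" using z(1) u(1) by (simp only: m_assoc m_closed)
      also have "\<dots> = z \<otimes> (u \<otimes> u) \<otimes> z" using z u(1) by (simp add: m_assoc)
      also have "\<dots> = \<one>" using z u by simp
      finally have "a [^] (4 * j) = \<one>"
        using int_pow_mult[of a "j + j" "j + j"] by (simp add: c_def)
      then have "int m dvd 2 * (2 * j)" by (simp add: int_pow_eq_id m_def)
      moreover have "coprime (int m) 2" using False by simp
      ultimately have "int m dvd 2 * j" by (simp only: coprime_dvd_mult_right_iff)
      then have "c = \<one>" by (simp add: c_def m_def int_pow_eq_id)
      then have zuz': "z \<otimes> u \<otimes> z = u" using zuz u(1) by simp
      have "z \<otimes> u = z \<otimes> u \<otimes> (z \<otimes> z)" using z u(1) by simp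
      also have "\<dots> = z \<otimes> u \<otimes> z \<otimes> z" using z(1) u(1) by (simp add: m_assoc)
      also have "\<dots> = u \<otimes> z" by (simp only: zuz')
      finally show ?thesis .
    qed
    \<comment> \<open>Since \<open>x0\<close> is no power of \<open>a\<close>, its factor
      \<open>z\<close> is nontrivial. It commutes with both factors of every element, so it is the
      central involution sought.\<close>
    obtain i :: int and z where z: "z \<in> carrier G" "z \<otimes> z = \<one>" "x0 = a [^] i \<otimes> z"
      using decomp[OF x0(1)] by blast
    have "z \<noteq> \<one>" using z x0(2)[of i] by auto
    then have "ord z = 2" using ord_eq_2I z by blast
    moreover have "z \<otimes> g = g \<otimes> z" if g: "g \<in> carrier G" for g
    proof -
      obtain k :: int and u where u: "u \<in> carrier G" "u \<otimes> u = \<one>" "g = a [^] k \<otimes> u"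
        using decomp[OF g] by blast
      have "z \<otimes> g = z \<otimes> a [^] k \<otimes> u"
        using u(1,3) z(1) by (simp add: m_assoc)
      also have "\<dots> = a [^] k \<otimes> z \<otimes> u" by (simp only: pow_central[OF z(1)])
      also have "\<dots> = a [^] k \<otimes> (z \<otimes> u)" using u(1) z(1) by (simp add: m_assoc)
      also have "\<dots> = a [^] k \<otimes> (u \<otimes> z)" by (simp only: commute[OF z(1,2) u(1,2)])
      also have "\<dots> = g \<otimes> z" using u(1,3) z(1) by (simp add: m_assoc)
      finally show ?thesis .
    qed
    ultimately show ?thesis using z(1) by (auto simp: group_center_def)
  qed
qed

end

section \<open>From a Lee metric to its weight, and the conclusion\<close>

lemma Lee_metric_imp_lee_weight:
  assumes "group G" "\<not> cyclic_group G" "Lee_metric G d"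
  obtains a where "lee_weight G (weight G d) a"
proof -
  interpret group G by fact
  define w where "w = weight G d"
  have metric: "Metric_space (carrier G) (\<lambda>x y. real_of_int (d x y))"
    and inv_d: "\<And>g g' h. \<lbrakk>g \<in> carrier G; g' \<in> carrier G; h \<in> carrier G\<rbrakk>
      \<Longrightarrow> d (g \<otimes>\<^bsub>G\<^esub> h) (g' \<otimes>\<^bsub>G\<^esub> h) = d g g'"
    and gap: "gapless G d" and part: "metric_partition G d = Lee_partition G"
    using assms(3) by (auto simp: Lee_metric_def group_metric_def)
  interpret M: Metric_space "carrier G" "\<lambda>x y. real_of_int (d x y)" by (fact metric)
  have d_nonneg: "0 \<le> d x y" for x y using M.nonneg[of x y] by simp
  have d_comm: "d x y = d y x" for x y using M.commute[of x y] by simp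
  have d_tri: "d x z \<le> d x y + d y z"
    if "x \<in> carrier G" "y \<in> carrier G" "z \<in> carrier G" for x y z
    using M.triangle[OF that] by linarith
  define R where "R = {(g, h) \<in> carrier G \<times> carrier G. w g = w h}"
  have quot: "carrier G // R = Lee_partition G"
    using part by (simp add: metric_partition_def R_def w_def)
  \<comment> \<open>The Lee partition only provides some \<open>b\<close> whose pair is the class of
    \<open>x\<close>; as \<open>x\<close> lies in it, \<open>x\<close> is \<open>b\<close> or its
    inverse, and the pairs agree.\<close>
  have block: "R `` {x} = {x, inv\<^bsub>G\<^esub> x}" if x: "x \<in> carrier G" for x
  proof -
    have "R `` {x} \<in> Lee_partition G" using x quot quotientI by fastforce
    then obtain b where b: "b \<in> carrier G" "R `` {x} = {b, inv\<^bsub>G\<^esub> b}"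
      by (auto simp: Lee_partition_def)
    moreover have "x \<in> R `` {x}" using x by (auto simp: R_def)
    ultimately consider "x = b" | "x = inv\<^bsub>G\<^esub> b" by blast
    then have "{x, inv\<^bsub>G\<^esub> x} = {b, inv\<^bsub>G\<^esub> b}"
    proof cases
      case 2
      then show ?thesis using b(1) by (simp only: inv_inv insert_commute[of b])
    qed (simp only:)
    then show ?thesis using b(2) by (simp only:)
  qed
  have one: "w \<one>\<^bsub>G\<^esub> = 0"
    using M.zero[OF one_closed one_closed] unfolding w_def weight_def of_int_eq_0_iff by blast
  obtain x0 where x0: "x0 \<in> carrier G" "x0 \<noteq> \<one>\<^bsub>G\<^esub>"
  proof -
    have "carrier G \<noteq> {\<one>\<^bsub>G\<^esub>}"
      using assms(1,2) trivial_imp_cyclic_group by (auto simp: trivial_group_def)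
    then show thesis using that one_closed by blast
  qed
  have "1 \<in> w ` carrier G"
  proof (cases "finite (metric_partition G d)")
    case True
    \<comment> \<open>A class other than that of the identity, so the interval of values in
      \<open>gapless\<close> reaches at least 1.\<close>
    have "R `` {x0} \<in> metric_partition G d - {{\<one>\<^bsub>G\<^esub>}}"
      using block[OF x0(1)] x0 part quot quotientI[of x0 "carrier G" R] by auto
    then have "0 < card (metric_partition G d - {{\<one>\<^bsub>G\<^esub>}})"
      using True card_gt_0_iff by blast
    then have "1 \<le> int (card (metric_partition G d - {{\<one>\<^bsub>G\<^esub>}}))"
      by linarith
    then show ?thesis using gap True unfolding gapless_def w_def by simp
  next
    case False
    then show ?thesis using gap by (simp add: gapless_def w_def)
  qed
  then obtain a where a: "a \<in> carrier G" "w a = 1" by auto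
  have "lee_weight G w a"
  proof
    fix x y assume x: "x \<in> carrier G"
    show "0 \<le> w x" by (simp add: w_def weight_def d_nonneg)
    show inv: "w (inv\<^bsub>G\<^esub> x) = w x"
      using inv_d[of "inv\<^bsub>G\<^esub> x" "\<one>\<^bsub>G\<^esub>" x] x d_comm by (simp add: w_def weight_def)
    assume y: "y \<in> carrier G"
    \<comment> \<open>Triangle inequality through \<open>y\<close>; right invariance turns the
      distance from the product to \<open>y\<close> into \<open>w x\<close>.\<close>
    show "w (x \<otimes>\<^bsub>G\<^esub> y) \<le> w x + w y"
      using d_tri[of "x \<otimes>\<^bsub>G\<^esub> y" y "\<one>\<^bsub>G\<^esub>"] inv_d[of x "\<one>\<^bsub>G\<^esub>" y] x y
      by (simp add: w_def weight_def)
    assume "w x = w y"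
    then have "y \<in> R `` {x}" using x y by (simp add: R_def)
    then show "y = x \<or> y = inv\<^bsub>G\<^esub> x" using block[OF x] by simp
  qed (use one a in simp_all)
  then show thesis using that w_def by blast
qed

theorem theorem4p3:
  fixes G :: "('a, 'b) monoid_scheme"
  assumes "group G"
    and "\<not> cyclic_group G"
    and "G24 G \<noteq> carrier G"
    and "\<not> (\<exists>z\<in>group_center G. group.ord G z = 2)"
  shows "\<not> (\<exists>d. Lee_metric G d)"
proof
  assume "\<exists>d. Lee_metric G d"
  then obtain d a where "lee_weight G (weight G d) a"
    using Lee_metric_imp_lee_weight assms(1,2) by metis
  then interpret lee_weight G "weight G d" a .
  show False
    using G24_eq_carrier exists_central_involution assms(2-4) by blast
qed

end
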